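(* Let $\tau$ be a Bell diagonal two-qubit state, i.e. a state of the form $$\tau=\tfrac14\Big(I\otimes I+\sum_{i=1}^3 t_{ii}\,\sigma_i\otimes\sigma_i\Big).$$ Then for every classical channel $\Pi=\{p_{l|k}\}_{k,l\in\{0,1,2,3\}}$ (that is, $p_{l|k}\ge0$ and $\sum_{l=0}^3p_{l|k}=1$ for every $k$), the qubit channel simulated by noisy teleportation over $\tau$ with classical channel $\Pi$ is a Pauli channel.
   Context: $(\sigma_0,\sigma_1,\sigma_2,\sigma_3)=(I,\sigma_x,\sigma_y,\sigma_z)$ are the Pauli matrices. A Pauli channel is a qubit channel of the form $\rho\mapsto\sum_{i=0}^3p_i\sigma_i\rho\sigma_i$ with $(p_i)$ a probability distribution. Bell projectors: $E_0=|\Phi^+\rangle\langle\Phi^+|$, $E_1=|\Psi^+\rangle\langle\Psi^+|$, $E_2=|\Psi^-\rangle\langle\Psi^-|$, $E_3=|\Phi^-\rangle\langle\Phi^-|$, where $|\Phi^\pm\rangle=\frac1{\sqrt2}(|00\rangle\pm|11\rangle)$ and $|\Psi^\pm\rangle=\frac1{\sqrt2}(|01\rangle\pm|10\rangle)$. Noisy teleportation over a two-qubit state $\tau=\tau_{AB}$ with classical channel $\Pi$: Alice holds the input qubit $C$ in state $\rho$ and qubit $A$, Bob holds qubit $B$. Alice performs the Bell measurement $\{E_k\}_{k=0}^3$ on $CA$; when the outcome is $k$, Bob applies $\sigma_l$ to $B$ with probability $p_{l|k}$. The simulated qubit channel is $$\rho\mapsto\sum_{k,l=0}^3 p_{l|k}\;\sigma_l\,\mathrm{Tr}_{CA}\big[(E_k)_{CA}(\rho_C\otimes\tau_{AB})\big]\,\sigma_l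 .$$ *)

theory Defs
  imports "HOL-Analysis.Analysis"
begin

text \<open>
  The computational basis vectors \<open>|0>\<close> and \<open>|1>\<close> of a qubit are the components
  \<open>1\<close> and \<open>2\<close> of the index type \<open>2\<close> (so they follow the order of
  \<^const>\<open>vector\<close>). The basis of a composite system is indexed by the product of the index types.
\<close>

type_synonym qubit_op = "complex^2^2"
type_synonym two_qubit_op = "complex^(2 \<times> 2)^(2 \<times> 2)"

definition tensor ::
  "complex^'a^'a \<Rightarrow> complex^'b^'b \<Rightarrow> complex^('a \<times> 'b)^('a \<times> 'b)" (infixl "\<otimes>" 75)
  where "A \<otimes> B = (\<chi> i j. A $ fst i $ fst j * B $ snd i $ snd j)"

definition tensor_vec :: "complex^'a \<Rightarrow> complex^'b \<Rightarrow> complex^('a \<times> 'b)"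
  where "tensor_vec u v = (\<chi> i. u $ fst i * v $ snd i)"

text \<open>The canonical identification of \<open>C \<otimes> (A \<otimes> B)\<close> with \<open>(C \<otimes> A) \<otimes> B\<close>.\<close>

definition assoc_left ::
  "complex^('c::finite \<times> 'a::finite \<times> 'b::finite)^('c \<times> 'a \<times> 'b) \<Rightarrow> complex^(('c \<times> 'a) \<times> 'b)^(('c \<times> 'a) \<times> 'b)"
  where "assoc_left M =
    (\<chi> i j. M $ (fst (fst i), snd (fst i), snd i) $ (fst (fst j), snd (fst j), snd j))"

definition partial_trace_fst ::
  "complex^('a::finite \<times> 'b::finite)^('a \<times> 'b) \<Rightarrow> complex^'b^'b"
  where "partial_trace_fst M = (\<chi> i j. \<Sum>k\<in>UNIV. M $ (k, i) $ (k, j))"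

definition positive_semidefinite :: "complex^'n^'n \<Rightarrow> bool"
  where "positive_semidefinite A \<longleftrightarrow>
    (\<forall>v. (\<Sum>i\<in>UNIV. cnj (v $ i) * (A *v v) $ i) \<in> \<real>\<^sub>\<ge>\<^sub>0)"

definition quantum_state :: "complex^'n^'n \<Rightarrow> bool"
  where "quantum_state A \<longleftrightarrow> positive_semidefinite A \<and> trace A = 1"

definition pauli :: "nat \<Rightarrow> qubit_op"
  where "pauli i =
    [mat 1,
     vector [vector [0, 1], vector [1, 0]],
     vector [vector [0, - \<i>], vector [\<i>, 0]],
     vector [vector [1, 0], vector [0, - 1]]] ! i"

text \<open>The map is required to have the stated form on all operators, not only on states.\<close>

definition pauli_channel :: "(qubit_op \<Rightarrow> qubit_op) \<Rightarrow> bool"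
  where "pauli_channel F \<longleftrightarrow>
    (\<exists>p :: nat \<Rightarrow> real. (\<forall>i\<in>{0..3}. 0 \<le> p i) \<and> (\<Sum>i=0..3. p i) = 1 \<and>
      (\<forall>\<rho>. F \<rho> = (\<Sum>i=0..3. p i *\<^sub>R (pauli i ** \<rho> ** pauli i))))"

definition ket0 :: "complex^2" where "ket0 = vector [1, 0]"
definition ket1 :: "complex^2" where "ket1 = vector [0, 1]"

definition ket_bra :: "complex^'n \<Rightarrow> complex^'n^'n"
  where "ket_bra v = (\<chi> i j. v $ i * cnj (v $ j))"

definition Phi_plus :: "complex^(2 \<times> 2)"
  where "Phi_plus = (1 / sqrt 2) *\<^sub>R (tensor_vec ket0 ket0 + tensor_vec ket1 ket1)"

definition Phi_minus :: "complex^(2 \<times> 2)"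
  where "Phi_minus = (1 / sqrt 2) *\<^sub>R (tensor_vec ket0 ket0 - tensor_vec ket1 ket1)"

definition Psi_plus :: "complex^(2 \<times> 2)"
  where "Psi_plus = (1 / sqrt 2) *\<^sub>R (tensor_vec ket0 ket1 + tensor_vec ket1 ket0)"

definition Psi_minus :: "complex^(2 \<times> 2)"
  where "Psi_minus = (1 / sqrt 2) *\<^sub>R (tensor_vec ket0 ket1 - tensor_vec ket1 ket0)"

definition bell_projector :: "nat \<Rightarrow> two_qubit_op"
  where "bell_projector k =
    [ket_bra Phi_plus, ket_bra Psi_plus, ket_bra Psi_minus, ket_bra Phi_minus] ! k"

definition bell_diagonal_state :: "two_qubit_op \<Rightarrow> bool"
  where "bell_diagonal_state \<tau> \<longleftrightarrow> quantum_state \<tau> \<and>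
    (\<exists>t :: nat \<Rightarrow> real.
      \<tau> = (1 / 4) *\<^sub>R (mat 1 \<otimes> mat 1 + (\<Sum>i=1..3. t i *\<^sub>R (pauli i \<otimes> pauli i))))"

text \<open>A classical channel is a function \<open>p\<close> with \<open>p k l\<close> the probability of \<open>l\<close> given \<open>k\<close>.\<close>

definition classical_channel :: "(nat \<Rightarrow> nat \<Rightarrow> real) \<Rightarrow> bool"
  where "classical_channel p \<longleftrightarrow>
    (\<forall>k\<in>{0..3}. (\<forall>l\<in>{0..3}. 0 \<le> p k l) \<and> (\<Sum>l=0..3. p k l) = 1)"

definition noisy_teleportation ::
  "two_qubit_op \<Rightarrow> (nat \<Rightarrow> nat \<Rightarrow> real) \<Rightarrow> qubit_op \<Rightarrow> qubit_op"
  where "noisy_teleportation \<tau> p \<rho> =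
    (\<Sum>k=0..3. \<Sum>l=0..3. p k l *\<^sub>R
      (pauli l **
        partial_trace_fst ((bell_projector k \<otimes> mat 1) ** assoc_left (\<rho> \<otimes> \<tau>)) **
        pauli l))"

end

theory Submission
  imports Defs
begin

text \<open>
  Up to a phase, the \<open>k\<close>-th Bell vector has the entries of \<open>\<sigma>\<^sub>k\<close> divided by \<open>sqrt 2\<close>. Teleporting over
  the \<open>j\<close>-th Bell state with measurement outcome \<open>k\<close> therefore conjugates the input by \<open>\<sigma>\<^sub>j \<sigma>\<^sub>k\<close>, with
  probability \<open>1/4\<close>. A Bell diagonal state is a convex combination of Bell projectors, its
  weights being nonnegative because they are the values of its quadratic form at the Bell vectors.
  Since the Pauli matrices form a group up to phases, the simulated channel is a convex combination
  of conjugations by Pauli matrices.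
\<close>

definition pauli_conj :: "nat \<Rightarrow> qubit_op \<Rightarrow> qubit_op"
  where "pauli_conj i \<rho> = pauli i ** \<rho> ** pauli i"

text \<open>Row-major vectorization: it turns vectors of a bipartite system into matrices, and the
  maximally entangled ones into nonzero multiples of unitaries.\<close>

definition vec_of_matrix :: "complex^'b^'a \<Rightarrow> complex^('a \<times> 'b)"
  where "vec_of_matrix M = (\<chi> i. M $ fst i $ snd i)"

definition adjoint_matrix :: "complex^'b^'a \<Rightarrow> complex^'a^'b"
  where "adjoint_matrix M = (\<chi> i j. cnj (M $ j $ i))"

lemma sum_UNIV_prod:
  "(\<Sum>x\<in>(UNIV :: ('a::finite \<times> 'b::finite) set). f x) = (\<Sum>a\<in>UNIV. \<Sum>b\<in>UNIV. f (a, b))"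
  by (simp add: sum.cartesian_product UNIV_Times_UNIV[symmetric] del: UNIV_Times_UNIV)

lemma atLeastAtMost_0_3: "{0..3} = {0, Suc 0, 2, 3}"
  by auto

lemma index_0_3_cases:
  assumes "k \<in> {0..3}"
  obtains "k = 0" | "k = Suc 0" | "k = 2" | "k = 3"
  using assms by (auto simp: atLeastAtMost_0_3 simp del: atLeastAtMost_iff)

lemma pauli_simps:
  "pauli 0 = mat 1"
  "pauli (Suc 0) = vector [vector [0, 1], vector [1, 0]]"
  "pauli 2 = vector [vector [0, - \<i>], vector [\<i>, 0]]"
  "pauli 3 = vector [vector [1, 0], vector [0, - 1]]"
  by (simp_all add: pauli_def eval_nat_numeral)

lemma bell_projector_simps:
  "bell_projector 0 = ket_bra Phi_plus"
  "bell_projector (Suc 0) = ket_bra Psi_plus"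
  "bell_projector 2 = ket_bra Psi_minus"
  "bell_projector 3 = ket_bra Phi_minus"
  by (simp_all add: bell_projector_def eval_nat_numeral)

text \<open>The vectorized Pauli matrices have squared norm 2, hence the factor 1/2. Only
  \<open>pauli 2\<close> yields a nontrivial phase, -i against \<open>Psi_minus\<close>, and the
  projector cancels it.\<close>

lemma bell_projector_eq:
  assumes "k \<in> {0..3}"
  shows "bell_projector k = (1/2) *\<^sub>R ket_bra (vec_of_matrix (pauli k))"
proof -
  have "complex_of_real (sqrt 2) * complex_of_real (sqrt 2) = 2"
    by (simp flip: of_real_mult)
  then show ?thesis
    using assms
    by (elim index_0_3_cases)
       (simp_all add: bell_projector_simps ket_bra_def vec_of_matrix_def pauli_simps
        Phi_plus_def Phi_minus_def Psi_plus_def Psi_minus_def tensor_vec_def ket0_def ket1_def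
        vec_eq_iff forall_2 mat_def scaleR_conv_of_real[where 'a = complex])
qed

lemma adjoint_matrix_pauli:
  assumes "k \<in> {0..3}"
  shows "adjoint_matrix (pauli k) = pauli k"
  using assms
  by (elim index_0_3_cases) (simp_all add: adjoint_matrix_def pauli_simps vec_eq_iff forall_2 mat_def)

text \<open>\<open>\<sigma>\<^sub>j\<close> is symmetric or antisymmetric, and the two signs cancel.\<close>

lemma transpose_pauli_conj:
  assumes "j \<in> {0..3}"
  shows "transpose (pauli j) ** X ** adjoint_matrix (transpose (pauli j)) = pauli_conj j X"
  using assms
  by (elim index_0_3_cases) (simp_all add: adjoint_matrix_def pauli_conj_def pauli_simps vec_eq_iff forall_2
      mat_def transpose_def matrix_matrix_mult_def sum_2)

text \<open>For a pure input u, contracting C and A with the bra of M leaves on B the vector with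
  entries sum over c, a of \<open>cnj (M $ c $ a) * u $ c * N $ a $ b\<close>. This is transpose(N)
  adjoint(M) u, so the map has this single Kraus operator.\<close>

lemma partial_trace_ket_bra:
  fixes M N \<rho> :: qubit_op
  shows "partial_trace_fst
      ((ket_bra (vec_of_matrix M) \<otimes> mat 1) ** assoc_left (\<rho> \<otimes> ket_bra (vec_of_matrix N))) =
    transpose N ** (adjoint_matrix M ** \<rho> ** M) ** adjoint_matrix (transpose N)"
  by (simp add: vec_eq_iff forall_2 partial_trace_fst_def matrix_matrix_mult_def sum_UNIV_prod sum_2
      tensor_def mat_def assoc_left_def ket_bra_def vec_of_matrix_def adjoint_matrix_def transpose_def
      algebra_simps)

text \<open>Up to phases, the Pauli matrices multiply like the bitwise XOR of their indices.\<close>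

lemma pauli_conj_comp:
  assumes "i \<in> {0..3}" "j \<in> {0..3}"
  shows "pauli_conj i (pauli_conj j \<rho>) = pauli_conj (xor i j) \<rho>"
  using assms
  by (elim index_0_3_cases)
     (simp_all add: pauli_conj_def pauli_simps vec_eq_iff forall_2 mat_def matrix_matrix_mult_def
      sum_2 algebra_simps)

lemma xor_in_0_3:
  fixes i j :: nat
  assumes "i \<in> {0..3}" "j \<in> {0..3}"
  shows "xor i j \<in> {0..3}"
  using assms by (elim index_0_3_cases) simp_all

lemma bell_diagonal_state_decomposition:
  assumes "bell_diagonal_state \<tau>"
  obtains q where "\<And>j. j \<in> {0..3} \<Longrightarrow> 0 \<le> q j" "(\<Sum>j=0..3. q j) = (1::real)"
    "\<tau> = (\<Sum>j=0..3. q j *\<^sub>R bell_projector j)"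
proof -
  obtain t :: "nat \<Rightarrow> real" where psd: "positive_semidefinite \<tau>" and
    t: "\<tau> = (1 / 4) *\<^sub>R (mat 1 \<otimes> mat 1 + (\<Sum>i=1..3. t i *\<^sub>R (pauli i \<otimes> pauli i)))"
    using assms unfolding bell_diagonal_state_def quantum_state_def by blast
  have range: "{Suc 0..3} = {Suc 0, 2, 3}" by auto
  \<comment> \<open>The Bell vectors are joint eigenvectors of the
    \<open>pauli i \<otimes> pauli i\<close>. The signs in row j are the eigenvalues at the j-th
    one, so \<open>q j\<close> is the eigenvalue of \<tau> there.\<close>
  define q where "q j = [1 + t 1 - t 2 + t 3, 1 + t 1 + t 2 - t 3,
    1 - t 1 - t 2 - t 3, 1 - t 1 + t 2 + t 3] ! j / 4" for j
  have q: "q 0 = (1 + t 1 - t 2 + t 3) / 4" "q (Suc 0) = (1 + t 1 + t 2 - t 3) / 4"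
    "q 2 = (1 - t 1 - t 2 - t 3) / 4" "q 3 = (1 - t 1 + t 2 + t 3) / 4"
    by (simp_all add: q_def eval_nat_numeral)
  show thesis
  proof
    fix j :: nat
    assume j: "j \<in> {0..3}"
    let ?v = "vec_of_matrix (pauli j)"
    \<comment> \<open>The factor 2 is the squared norm of \<open>?v\<close>.\<close>
    have "(\<Sum>i\<in>UNIV. cnj (?v $ i) * (\<tau> *v ?v) $ i) = of_real (2 * q j)"
      using j
      by (elim index_0_3_cases)
         (simp_all add: t q range sum_UNIV_prod sum_2 matrix_vector_mult_def
          vec_of_matrix_def tensor_def pauli_simps mat_def scaleR_conv_of_real[where 'a = complex]
          field_simps)
    moreover have "(\<Sum>i\<in>UNIV. cnj (?v $ i) * (\<tau> *v ?v) $ i) \<in> \<real>\<^sub>\<ge>\<^sub>0"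
      using psd by (simp add: positive_semidefinite_def)
    ultimately show "0 \<le> q j"
      by (simp add: complex_nonneg_Reals_iff)
  next
    \<comment> \<open>Each \<open>t i\<close> occurs twice with each sign and cancels.\<close>
    show "(\<Sum>j=0..3. q j) = 1"
      by (simp add: atLeastAtMost_0_3 q field_simps)
  next
    have "\<tau> = (\<Sum>j=0..3. q j *\<^sub>R (1/2) *\<^sub>R ket_bra (vec_of_matrix (pauli j)))"
      by (simp add: atLeastAtMost_0_3 t q range vec_eq_iff forall_2 vec_of_matrix_def ket_bra_def
          tensor_def pauli_simps mat_def scaleR_conv_of_real[where 'a = complex] field_simps)
    then show "\<tau> = (\<Sum>j=0..3. q j *\<^sub>R bell_projector j)"
      by (simp add: bell_projector_eq)
  qed
qed

lemma partial_trace_bell_projectors: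
  assumes "k \<in> {0..3}" "j \<in> {0..3}"
  shows "partial_trace_fst ((bell_projector k \<otimes> mat 1) ** assoc_left (\<rho> \<otimes> bell_projector j)) =
    (1/4) *\<^sub>R pauli_conj j (pauli_conj k \<rho>)"
proof -
  \<comment> \<open>The factors 1/2 of the measured projector and of the shared one combine to 1/4,
    leaving unnormalized vectors to contract.\<close>
  have "partial_trace_fst ((((1/2) *\<^sub>R A) \<otimes> mat 1) ** assoc_left (\<rho> \<otimes> ((1/2) *\<^sub>R B))) =
      (1/4) *\<^sub>R partial_trace_fst ((A \<otimes> mat 1) ** assoc_left (\<rho> \<otimes> B))" for A B :: two_qubit_op
    by (simp add: vec_eq_iff partial_trace_fst_def matrix_matrix_mult_def tensor_def assoc_left_def
        scaleR_sum_right)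
  then show ?thesis
    using assms
    by (simp add: bell_projector_eq partial_trace_ket_bra transpose_pauli_conj adjoint_matrix_pauli)
       (simp add: pauli_conj_def)
qed

lemma partial_trace_linear:
  fixes f :: "'j \<Rightarrow> complex^('a::finite \<times> 'b::finite)^('a \<times> 'b)"
  shows "partial_trace_fst (M ** assoc_left (\<rho> \<otimes> (\<Sum>j\<in>J. q j *\<^sub>R f j))) =
    (\<Sum>j\<in>J. q j *\<^sub>R partial_trace_fst (M ** assoc_left (\<rho> \<otimes> f j)))"
proof -
  have "linear (\<lambda>\<tau>. partial_trace_fst (M ** assoc_left (\<rho> \<otimes> \<tau>)))"
    by (intro linearI)
       (simp_all add: vec_eq_iff partial_trace_fst_def matrix_matrix_mult_def tensor_def
         assoc_left_def scaleR_sum_right sum.distrib algebra_simps)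
  then show ?thesis
    by (simp add: linear_sum[OF \<open>linear _\<close>] linear_cmul[OF \<open>linear _\<close>])
qed

lemma pauli_conj_linear:
  "pauli_conj i (\<Sum>j\<in>J. q j *\<^sub>R f j) = (\<Sum>j\<in>J. q j *\<^sub>R pauli_conj i (f j))"
proof -
  have "linear (pauli_conj i)"
    by (intro linearI)
       (simp_all add: pauli_conj_def vec_eq_iff matrix_matrix_mult_def scaleR_sum_right sum.distrib
         sum_distrib_left algebra_simps)
  then show ?thesis
    by (simp add: linear_sum[OF \<open>linear _\<close>] linear_cmul[OF \<open>linear _\<close>])
qed

text \<open>Allows any finite index set, with repeated Pauli indices: terms with the same index are
  merged.\<close>

lemma pauli_channel_convex_combination:
  assumes "finite A" "\<And>a. a \<in> A \<Longrightarrow> 0 \<le> w a" "sum w A = 1" "\<And>a. a \<in> A \<Longrightarrow> m a \<in> {0..3}"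
    and F: "\<And>\<rho>. F \<rho> = (\<Sum>a\<in>A. w a *\<^sub>R pauli_conj (m a) \<rho>)"
  shows "pauli_channel F"
proof -
  \<comment> \<open>The pushforward of the weights along \<open>m\<close>; an index that is not
    attained gets the empty sum 0.\<close>
  define r where "r i = sum w {a \<in> A. m a = i}" for i
  have img: "m ` A \<subseteq> {0..3}" using assms(4) by blast
  have "(\<Sum>i=0..3. r i) = 1"
    unfolding r_def using sum.group[OF assms(1) _ img, of w] assms(3) by simp
  moreover have "F \<rho> = (\<Sum>i=0..3. r i *\<^sub>R (pauli i ** \<rho> ** pauli i))" for \<rho>
  proof -
    have "F \<rho> = (\<Sum>i=0..3. \<Sum>a\<in>{a \<in> A. m a = i}. w a *\<^sub>R pauli_conj (m a) \<rho>)"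
      unfolding F using sum.group[OF assms(1) _ img, of "\<lambda>a. w a *\<^sub>R pauli_conj (m a) \<rho>"] by simp
    also have "\<dots> = (\<Sum>i=0..3. r i *\<^sub>R pauli_conj i \<rho>)"
      by (simp add: r_def scaleR_sum_left)
    finally show ?thesis by (simp add: pauli_conj_def)
  qed
  moreover have "\<forall>i\<in>{0..3}. 0 \<le> r i"
    unfolding r_def by (auto intro!: sum_nonneg assms(2))
  ultimately show ?thesis unfolding pauli_channel_def by blast
qed

theorem theorem12:
  fixes \<tau> :: "complex^(2 \<times> 2)^(2 \<times> 2)" and p :: "nat \<Rightarrow> nat \<Rightarrow> real"
  assumes "bell_diagonal_state \<tau>"
    and "classical_channel p"
  shows "pauli_channel (noisy_teleportation \<tau> p)"
proof -
  obtain q where q: "\<And>j. j \<in> {0..3} \<Longrightarrow> 0 \<le> q j" "(\<Sum>j=0..3. q j) = (1::real)"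
    and \<tau>: "\<tau> = (\<Sum>j=0..3. q j *\<^sub>R bell_projector j)"
    using bell_diagonal_state_decomposition[OF assms(1)] by blast
  have p: "0 \<le> p k l" "(\<Sum>l=0..3. p k l) = 1" if "k \<in> {0..3}" "l \<in> {0..3}" for k l
    using assms(2) that unfolding classical_channel_def by blast+
  let ?A = "{0..3::nat} \<times> {0..3::nat} \<times> {0..3::nat}"
  \<comment> \<open>A triple consists of the outcome k, the correction l and the Bell component j of
    \<tau>. The input is conjugated by index k, then j, then l, and the indices combine by
    XOR.\<close>
  let ?w = "\<lambda>(k, l, j). p k l * q j / 4"
  let ?m = "\<lambda>(k, l, j). xor l (xor j k)"
  show ?thesis
  proof (rule pauli_channel_convex_combination[where A = ?A and w = ?w and m = ?m])
    have "sum ?w ?A = (\<Sum>k=0..3. \<Sum>l=0..3. \<Sum>j=0..3. p k l * q j / 4)"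
      by (simp add: sum.cartesian_product)
    also have "\<dots> = (\<Sum>k=0..3. (\<Sum>l=0..3. p k l) * (\<Sum>j=0..3. q j) / 4)"
      by (simp add: sum_product sum_divide_distrib)
    \<comment> \<open>Each of the four outcomes contributes 1/4.\<close>
    also have "\<dots> = 1"
      using p(2) q(2) by simp
    finally show "sum ?w ?A = 1" .
  next
    fix \<rho>
    have "noisy_teleportation \<tau> p \<rho> = (\<Sum>k=0..3. \<Sum>l=0..3. p k l *\<^sub>R
        pauli_conj l (\<Sum>j=0..3. q j *\<^sub>R (1/4) *\<^sub>R pauli_conj j (pauli_conj k \<rho>)))"
      unfolding noisy_teleportation_def \<tau> partial_trace_linear pauli_conj_def[symmetric]
      by (simp add: partial_trace_bell_projectors)
    also have "\<dots> = (\<Sum>k=0..3. \<Sum>l=0..3. \<Sum>j=0..3. (p k l * q j / 4) *\<^sub>R pauli_conj (xor l (xor j k)) \<rho>)"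
      by (simp add: pauli_conj_linear scaleR_sum_right pauli_conj_comp xor_in_0_3
          del: atLeastAtMost_iff)
    also have "\<dots> = (\<Sum>a\<in>?A. ?w a *\<^sub>R pauli_conj (?m a) \<rho>)"
      by (simp add: sum.cartesian_product split_def)
    finally show "noisy_teleportation \<tau> p \<rho> =
        (\<Sum>a\<in>?A. ?w a *\<^sub>R pauli_conj (?m a) \<rho>)" .
  qed (use p(1) q(1) xor_in_0_3 in \<open>auto simp del: atLeastAtMost_iff\<close>)
qed

end
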